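(* For a weighted graph $(X,b,m)$ the following assertions are equivalent. (i) $(X,b,m)$ admits an intrinsic pseudo metric with finite balls. (ii) $(X,b,m)$ is complete, i.e., there exists a non-decreasing sequence $(\eta_k)$ in $C_c(X)$ such that $\eta_k\to1$ pointwise and $\Gamma(\eta_k)\to0$ uniformly as $k\to\infty$. If, additionally, for every $y\in X$ the function $X\to\mathbb{R}$, $x\mapsto b(x,y)/m(x)$, belongs to $C_0(X)$, then these assertions are equivalent to the following. (iii) $(X,b,m)$ is $\chi$-complete, i.e., there exists a non-decreasing sequence $(\eta_k)$ in $C_c(X)$ such that $\eta_k\to1$ pointwise and $(\Gamma(\eta_k))$ is uniformly bounded.
   Context: A weighted graph $(X,b,m)$ consists of an at most countable set $X$ (with the discrete topology), an edge weight $b\colon X\times X\to[0,\infty)$ with $b(x,x)=0$, $b(x,y)=b(y,x)$ and $\sum_{y\in X}b(x,y)<\infty$ for all $x,y\in X$, and a function $m\colon X\to(0,\infty)$. (Local finiteness is not assumed.) $C_c(X)$ is the space of functions on $X$ with finite support; $C_0(X)$ is the closure of $C_c(X)$ in $\ell^\infty(X)$. A non-decreasing sequence in $C_c(X)$ means a sequence of real-valued functions that is pointwise non-decreasing in $k$. For $f\colon X\to\mathbb{C}$, $\Gamma(f)(x)=\frac1{m(x)}\sum_yb(x,y)|f(x)-f(y)|^2$. A pseudo metric $d\colon X\times X\to[0,\infty)$ is intrinsic for $(X,b,m)$ if $\frac1{m(x)}\sum_yb(x,y)d(x,y)^2\le1$ for all $x\in X$. It has finite balls if every ball of finite radius with respect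 to $d$ is a finite subset of $X$. *)

theory Defs
  imports "HOL-Analysis.Analysis"
begin

text \<open>
  Weighted graphs live on a carrier set \<open>X\<close>; the values of \<open>b\<close> and \<open>m\<close> outside the carrier
  are irrelevant. Local finiteness is not required.
\<close>

locale weighted_graph =
  fixes X :: "'a set" and b :: "'a \<Rightarrow> 'a \<Rightarrow> real" and m :: "'a \<Rightarrow> real"
  assumes countable_vertices: "countable X"
    and b_nonneg: "\<And>x y. x \<in> X \<Longrightarrow> y \<in> X \<Longrightarrow> 0 \<le> b x y"
    and b_diag: "\<And>x. x \<in> X \<Longrightarrow> b x x = 0"
    and b_sym: "\<And>x y. x \<in> X \<Longrightarrow> y \<in> X \<Longrightarrow> b x y = b y x"
    and b_summable: "\<And>x. x \<in> X \<Longrightarrow> b x summable_on X"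
    and m_pos: "\<And>x. x \<in> X \<Longrightarrow> 0 < m x"

text \<open>
  Functions on \<open>X\<close> are the elements of \<open>extensional X\<close>, as in the library's metric space
  \<open>fspace X\<close> of bounded functions with the supremum distance, which for
  \<open>'b = real\<close> or \<open>'b = complex\<close> is \<open>\<ell>\<^sup>\<infinity>(X)\<close>.
\<close>

definition Cc :: "'a set \<Rightarrow> ('a \<Rightarrow> 'b::real_normed_vector) set" where
  "Cc X = {f \<in> extensional X. finite {x \<in> X. f x \<noteq> 0}}"

definition linf_topology :: "'a set \<Rightarrow> ('a \<Rightarrow> 'b::real_normed_vector) topology" where
  "linf_topology X = Metric_space.mtopology (Met_TC.fspace X) (Met_TC.fdist X)"

definition C0 :: "'a set \<Rightarrow> ('a \<Rightarrow> 'b::real_normed_vector) set" where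
  "C0 X = linf_topology X closure_of Cc X"

text \<open>
  The sum over \<open>X\<close> defaults to \<open>0\<close> when it diverges; for \<open>f \<in> Cc X\<close> it always converges,
  see \<open>\<Gamma>_summable\<close> below.
\<close>

definition \<Gamma> :: "'a set \<Rightarrow> ('a \<Rightarrow> 'a \<Rightarrow> real) \<Rightarrow> ('a \<Rightarrow> real) \<Rightarrow>
    ('a \<Rightarrow> 'b::real_normed_vector) \<Rightarrow> 'a \<Rightarrow> real" where
  "\<Gamma> X b m f x = (1 / m x) * (\<Sum>\<^sub>\<infinity>y\<in>X. b x y * (norm (f x - f y))\<^sup>2)"

definition pseudo_metric_on :: "'a set \<Rightarrow> ('a \<Rightarrow> 'a \<Rightarrow> real) \<Rightarrow> bool" where
  "pseudo_metric_on X d \<longleftrightarrow>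
     (\<forall>x\<in>X. \<forall>y\<in>X. 0 \<le> d x y) \<and>
     (\<forall>x\<in>X. d x x = 0) \<and>
     (\<forall>x\<in>X. \<forall>y\<in>X. d x y = d y x) \<and>
     (\<forall>x\<in>X. \<forall>y\<in>X. \<forall>z\<in>X. d x z \<le> d x y + d y z)"

text \<open>Summability is explicit, since a divergent sum would otherwise count as \<open>0 \<le> 1\<close>.\<close>

definition intrinsic ::
  "'a set \<Rightarrow> ('a \<Rightarrow> 'a \<Rightarrow> real) \<Rightarrow> ('a \<Rightarrow> real) \<Rightarrow> ('a \<Rightarrow> 'a \<Rightarrow> real) \<Rightarrow> bool" where
  "intrinsic X b m d \<longleftrightarrow>
     (\<forall>x\<in>X. (\<lambda>y. b x y * (d x y)\<^sup>2) summable_on X \<and>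
             (1 / m x) * (\<Sum>\<^sub>\<infinity>y\<in>X. b x y * (d x y)\<^sup>2) \<le> 1)"

definition has_finite_balls :: "'a set \<Rightarrow> ('a \<Rightarrow> 'a \<Rightarrow> real) \<Rightarrow> bool" where
  "has_finite_balls X d \<longleftrightarrow> (\<forall>x\<in>X. \<forall>r. finite {y \<in> X. d x y \<le> r})"

definition nondecreasing_Cc_to_one :: "'a set \<Rightarrow> (nat \<Rightarrow> 'a \<Rightarrow> real) \<Rightarrow> bool" where
  "nondecreasing_Cc_to_one X \<eta> \<longleftrightarrow>
     (\<forall>k. \<eta> k \<in> Cc X) \<and>
     (\<forall>x\<in>X. incseq (\<lambda>k. \<eta> k x)) \<and>
     (\<forall>x\<in>X. (\<lambda>k. \<eta> k x) \<longlonglongrightarrow> 1)"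

definition graph_complete ::
  "'a set \<Rightarrow> ('a \<Rightarrow> 'a \<Rightarrow> real) \<Rightarrow> ('a \<Rightarrow> real) \<Rightarrow> bool" where
  "graph_complete X b m \<longleftrightarrow>
     (\<exists>\<eta>. nondecreasing_Cc_to_one X \<eta> \<and>
          uniform_limit X (\<lambda>k. \<Gamma> X b m (\<eta> k)) (\<lambda>_. 0) sequentially)"

definition chi_complete ::
  "'a set \<Rightarrow> ('a \<Rightarrow> 'a \<Rightarrow> real) \<Rightarrow> ('a \<Rightarrow> real) \<Rightarrow> bool" where
  "chi_complete X b m \<longleftrightarrow>
     (\<exists>\<eta>. nondecreasing_Cc_to_one X \<eta> \<and>
          (\<exists>C. \<forall>k. \<forall>x\<in>X. \<Gamma> X b m (\<eta> k) x \<le> C))"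

lemma (in weighted_graph) \<Gamma>_summable:
  fixes f :: "'a \<Rightarrow> 'b::real_normed_vector"
  assumes f: "f \<in> Cc X" and x: "x \<in> X"
  shows "(\<lambda>y. b x y * (norm (f x - f y))\<^sup>2) summable_on X"
proof -
  have "finite (f ` {x \<in> X. f x \<noteq> 0})"
    using f by (simp add: Cc_def)
  then have "finite (insert 0 (f ` {x \<in> X. f x \<noteq> 0}))" by simp
  then have "bounded (insert 0 (f ` {x \<in> X. f x \<noteq> 0}))"
    by (rule finite_imp_bounded)
  then obtain B where B: "\<And>v. v \<in> insert 0 (f ` {x \<in> X. f x \<noteq> 0}) \<Longrightarrow> norm v \<le> B"
    unfolding bounded_iff by blast
  have fB: "norm (f y) \<le> B" if "y \<in> X" for y
    using B[of "f y"] that by (cases "f y = 0") auto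
  have "(\<lambda>y. b x y * (2 * B)\<^sup>2) summable_on X"
    using b_summable[OF x] by (rule summable_on_cmult_left)
  then show ?thesis
  proof (rule summable_on_comparison_test)
    fix y assume y: "y \<in> X"
    have "norm (f x - f y) \<le> 2 * B"
      using norm_triangle_ineq4[of "f x" "f y"] fB[OF x] fB[OF y] by linarith
    then have "(norm (f x - f y))\<^sup>2 \<le> (2 * B)\<^sup>2"
      by (intro power_mono) auto
    then show "b x y * (norm (f x - f y))\<^sup>2 \<le> b x y * (2 * B)\<^sup>2"
      using b_nonneg[OF x y] by (intro mult_left_mono)
    show "0 \<le> b x y * (norm (f x - f y))\<^sup>2"
      using b_nonneg[OF x y] by simp
  qed
qed

end

theory Submission
  imports Defs
begin

text \<open>
  Given an intrinsic pseudo metric with finite balls, the cutoffs \<open>max 0 (1 - d a x / (k + 1))\<close>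
  around a base point \<open>a\<close> are supported in balls and have Lipschitz constant \<open>1 / (k + 1)\<close>,
  so intrinsicness bounds their energy \<open>\<Gamma>\<close> by \<open>1 / (k + 1)\<^sup>2\<close>
  (\<open>graph_complete_of_intrinsic\<close>).

  Conversely (\<open>intrinsic_of_graph_complete\<close>), from cutoffs whose energy tends to zero one
  selects a subsequence \<open>\<phi>\<close> with \<open>\<Gamma> (\<phi> n) \<le> (1/2)^(n + 1)\<close> that converges to \<open>1\<close> geometrically
  fast at every vertex, and maps a vertex \<open>x\<close> to the sequence of values of the \<open>\<phi> n\<close> at \<open>x\<close>. The
  \<open>\<ell>\<^sup>2\<close> distance of two such sequences is a finite pseudo metric. It is intrinsic because
  its weighted square sum at \<open>x\<close>, divided by \<open>m x\<close>, is the sum of the energies of the \<open>\<phi> n\<close>. Its balls are finite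
  because a vertex outside the supports of \<open>N\<close> consecutive late cutoffs, which are at least
  \<open>1/2\<close> at the centre, has squared distance at least \<open>N / 4\<close> from the centre.

  Dropping finitely many cutoffs turns uniform convergence of the energies into a uniform bound.
  The way back from bounded energy is a Banach-Saks argument
  (\<open>graph_complete_of_chi_complete\<close>): Cesaro means of a subsequence whose differences are nearly
  orthogonal have energy \<open>O(1 / n)\<close>, and they stay monotone in \<open>n\<close>. The near orthogonality has to
  be uniform over the vertices, and this is where the hypothesis on \<open>C0\<close> enters
  (\<open>eventually_cross_energy_le\<close>): for finitely supported \<open>f\<close> the interaction of \<open>f\<close> with any
  bounded function is small outside a finite set, and on that set it tends to zero by dominated
  convergence.
\<close>

section \<open>Summation, finitely supported functions and functions vanishing at infinity\<close>

text \<open>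
  The majorant makes the partial sums over finite sets converge uniformly in \<open>k\<close>, which reduces
  the claim to a finite sum.
\<close>

lemma infsum_dominated_tendsto_0:
  fixes f :: "nat \<Rightarrow> 'a \<Rightarrow> real"
  assumes w: "w summable_on X"
    and le: "\<And>k x. x \<in> X \<Longrightarrow> \<bar>f k x\<bar> \<le> w x"
    and lim: "\<And>x. x \<in> X \<Longrightarrow> (\<lambda>k. f k x) \<longlonglongrightarrow> 0"
  shows "(\<lambda>k. \<Sum>\<^sub>\<infinity>x\<in>X. f k x) \<longlonglongrightarrow> 0"
proof (rule tendstoI)
  fix e :: real assume e: "e > 0"
  have "uniform_limit UNIV (\<lambda>F k. \<Sum>x\<in>F. f k x) (\<lambda>k. \<Sum>\<^sub>\<infinity>x\<in>X. f k x) (finite_subsets_at_top X)"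
    by (rule Weierstrass_m_test_general[OF _ w]) (use le in auto)
  from uniform_limitD[OF this half_gt_zero[OF e]]
  have "\<forall>\<^sub>F F in finite_subsets_at_top X. \<forall>k. dist (\<Sum>x\<in>F. f k x) (\<Sum>\<^sub>\<infinity>x\<in>X. f k x) < e / 2"
    by (simp only: ball_UNIV)
  then obtain F where F: "finite F" "F \<subseteq> X"
    and "\<forall>Y. finite Y \<and> F \<subseteq> Y \<and> Y \<subseteq> X \<longrightarrow>
      (\<forall>k. dist (\<Sum>x\<in>Y. f k x) (\<Sum>\<^sub>\<infinity>x\<in>X. f k x) < e / 2)"
    unfolding eventually_finite_subsets_at_top by (elim exE conjE)
  then have dF: "dist (\<Sum>x\<in>F. f k x) (\<Sum>\<^sub>\<infinity>x\<in>X. f k x) < e / 2" for k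
    by simp
  have "(\<lambda>k. \<Sum>x\<in>F. f k x) \<longlonglongrightarrow> (\<Sum>x\<in>F. 0)"
    using F by (intro tendsto_sum lim) auto
  then have "\<forall>\<^sub>F k in sequentially. dist (\<Sum>x\<in>F. f k x) 0 < e / 2"
    using e by (auto dest: tendstoD[where e = "e / 2"])
  then show "\<forall>\<^sub>F k in sequentially. dist (\<Sum>\<^sub>\<infinity>x\<in>X. f k x) 0 < e"
  proof eventually_elim
    case (elim k)
    then show ?case
      using dF[of k] dist_triangle3[of "\<Sum>\<^sub>\<infinity>x\<in>X. f k x" 0 "\<Sum>x\<in>F. f k x"] by linarith
  qed
qed

lemma Cc_bounded:
  fixes f :: "'a \<Rightarrow> real"
  assumes "f \<in> Cc X"
  obtains B where "0 \<le> B" "\<And>x. x \<in> X \<Longrightarrow> \<bar>f x\<bar> \<le> B"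
proof -
  have "finite (insert 0 (f ` {x \<in> X. f x \<noteq> 0}))"
    using assms by (simp add: Cc_def)
  then obtain B where B: "\<And>v. v \<in> insert 0 (f ` {x \<in> X. f x \<noteq> 0}) \<Longrightarrow> norm v \<le> B"
    using finite_imp_bounded bounded_iff by metis
  show thesis
  proof (rule that)
    show "0 \<le> B" using B[of 0] by simp
    show "\<bar>f x\<bar> \<le> B" if "x \<in> X" for x
      using B[of "f x"] that \<open>0 \<le> B\<close> by (cases "f x = 0") auto
  qed
qed

lemma Cc_add:
  fixes f g :: "'a \<Rightarrow> real"
  assumes "f \<in> Cc X" "g \<in> Cc X"
  shows "(\<lambda>x\<in>X. f x + g x) \<in> Cc X"
proof -
  have fin: "finite ({x \<in> X. f x \<noteq> 0} \<union> {x \<in> X. g x \<noteq> 0})"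
    using assms by (simp add: Cc_def)
  have "finite {x \<in> X. (\<lambda>x\<in>X. f x + g x) x \<noteq> 0}"
    by (rule finite_subset[OF _ fin]) force
  then show ?thesis unfolding Cc_def by blast
qed

lemma Cc_cmult:
  fixes f :: "'a \<Rightarrow> real"
  assumes "f \<in> Cc X"
  shows "(\<lambda>x\<in>X. c * f x) \<in> Cc X"
proof -
  have fin: "finite {x \<in> X. f x \<noteq> 0}"
    using assms by (simp add: Cc_def)
  have "finite {x \<in> X. (\<lambda>x\<in>X. c * f x) x \<noteq> 0}"
    by (rule finite_subset[OF _ fin]) force
  then show ?thesis unfolding Cc_def by blast
qed

text \<open>A finitely supported function within distance \<open>e\<close> of \<open>f\<close> is nonzero wherever \<open>\<bar>f\<bar> \<ge> e\<close>.\<close>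

lemma C0_finite_superlevel:
  fixes f :: "'a \<Rightarrow> real"
  assumes f: "f \<in> C0 X" and e: "e > 0"
  shows "finite {x \<in> X. e \<le> \<bar>f x\<bar>}"
proof -
  have "\<exists>g\<in>Cc X. g \<in> Metric_space.mball (Met_TC.fspace X) (Met_TC.fdist X) f e"
    using f e unfolding C0_def linf_topology_def
      Metric_space.metric_closure_of[OF Met_TC.Metric_space_funspace] by blast
  then obtain g where g: "g \<in> Cc X" "f \<in> Met_TC.fspace X" "g \<in> Met_TC.fspace X"
    and fg: "Met_TC.fdist X f g < e"
    by (auto simp: Metric_space.in_mball[OF Met_TC.Metric_space_funspace])
  have "dist (f x) (g x) < e" if "x \<in> X" for x
  proof -
    have "dist (f x) (g x) \<le> (SUP u\<in>X. dist (f u) (g u))"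
      using that g by (intro cSUP_upper Met_TC.bdd_above_dist) auto
    also have "\<dots> = Met_TC.fdist X f g"
      using that g by (auto simp: Met_TC.fdist_def)
    finally show ?thesis using fg by simp
  qed
  then have "{x \<in> X. e \<le> \<bar>f x\<bar>} \<subseteq> {x \<in> X. g x \<noteq> 0}"
    by (force simp: dist_real_def)
  with g(1) show ?thesis
    unfolding Cc_def using finite_subset by blast
qed

section \<open>Cesaro means\<close>

lemma incseq_cesaro_mean:
  fixes a :: "nat \<Rightarrow> real"
  assumes "incseq a"
  shows "incseq (\<lambda>n. (\<Sum>j\<le>n. a j) / real (Suc n))"
proof (rule incseq_SucI)
  fix n
  have "(\<Sum>j\<le>n. a j) \<le> (\<Sum>j\<le>n. a (Suc n))"
    using assms by (intro sum_mono) (auto simp: incseq_def)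
  then show "(\<Sum>j\<le>n. a j) / real (Suc n) \<le> (\<Sum>j\<le>Suc n. a j) / real (Suc (Suc n))"
    by (simp add: field_simps)
qed

lemma tendsto_cesaro_mean_incseq:
  fixes a :: "nat \<Rightarrow> real"
  assumes inc: "incseq a" and lim: "a \<longlonglongrightarrow> l"
  shows "(\<lambda>n. (\<Sum>j\<le>n. a j) / real (Suc n)) \<longlonglongrightarrow> l"
proof (rule LIMSEQ_I)
  fix e :: real assume e: "e > 0"
  have al: "a j \<le> l" for j
    using inc lim by (rule incseq_le)
  obtain J where J': "\<And>j. j \<ge> J \<Longrightarrow> norm (a j - l) < e / 2"
    using LIMSEQ_D[OF lim half_gt_zero[OF e]] by blast
  have J: "l - a j < e / 2" if "j \<ge> J" for j
    using J'[OF that] unfolding real_norm_def by linarith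
  \<comment> \<open>\<open>D\<close> bounds what the terms before \<open>J\<close> contribute; averaging makes it negligible.\<close>
  define D where "D = (\<Sum>j<J. l - a j)"
  have D: "D \<ge> 0" unfolding D_def using al by (intro sum_nonneg) auto
  obtain N where N: "D / (e / 2) < real N"
    using reals_Archimedean2 by blast
  show "\<exists>N. \<forall>n\<ge>N. norm ((\<Sum>j\<le>n. a j) / real (Suc n) - l) < e"
  proof (intro exI[of _ N] allI impI)
    fix n assume n: "N \<le> n"
    have eq: "l - (\<Sum>j\<le>n. a j) / real (Suc n) = (\<Sum>j\<le>n. l - a j) / real (Suc n)"
      by (simp add: sum_subtractf field_simps)
    have "(\<Sum>j\<le>n. l - a j) \<le> (\<Sum>j\<le>n. (if j < J then l - a j else 0) + e / 2)"
      using J al e by (intro sum_mono) (auto simp: not_less less_imp_le)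
    also have "\<dots> = (\<Sum>j\<in>{..n} \<inter> {..<J}. l - a j) + real (Suc n) * (e / 2)"
      by (simp add: sum.distrib sum.inter_restrict lessThan_def)
    also have "(\<Sum>j\<in>{..n} \<inter> {..<J}. l - a j) \<le> D"
      unfolding D_def using al by (intro sum_mono2) auto
    also have "D < real (Suc n) * (e / 2)"
    proof -
      have "D < real N * (e / 2)" using N e by (simp add: field_simps)
      also have "\<dots> \<le> real (Suc n) * (e / 2)" using n e by (intro mult_right_mono) auto
      finally show ?thesis .
    qed
    finally have "(\<Sum>j\<le>n. l - a j) < real (Suc n) * e" by (simp add: field_simps)
    then have "(\<Sum>j\<le>n. l - a j) / real (Suc n) < e" by (simp add: field_simps)
    moreover have "0 \<le> (\<Sum>j\<le>n. l - a j) / real (Suc n)"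
      using al by (intro divide_nonneg_nonneg sum_nonneg) auto
    ultimately show "norm ((\<Sum>j\<le>n. a j) / real (Suc n) - l) < e"
      using eq by auto
  qed
qed

section \<open>The square-summable distance of real sequences\<close>

definition l2_dist :: "(nat \<Rightarrow> real) \<Rightarrow> (nat \<Rightarrow> real) \<Rightarrow> real" where
  "l2_dist u v = sqrt (\<Sum>n. (u n - v n)\<^sup>2)"

text \<open>
  This follows from \<open>(u - v)\<^sup>2 \<le> 2 (c - u)\<^sup>2 + 2 (c - v)\<^sup>2\<close>. For the values of a sequence of
  cutoffs at two vertices the common limit \<open>c\<close> is \<open>1\<close>.
\<close>

lemma summable_square_diff:
  fixes u v :: "nat \<Rightarrow> real"
  assumes "summable (\<lambda>n. (c - u n)\<^sup>2)" "summable (\<lambda>n. (c - v n)\<^sup>2)"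
  shows "summable (\<lambda>n. (u n - v n)\<^sup>2)"
proof (rule summable_comparison_test')
  show "summable (\<lambda>n. 2 * (c - u n)\<^sup>2 + 2 * (c - v n)\<^sup>2)"
    using assms by (intro summable_add summable_mult)
  show "norm ((u n - v n)\<^sup>2) \<le> 2 * (c - u n)\<^sup>2 + 2 * (c - v n)\<^sup>2" if "n \<ge> 0" for n
    using zero_le_power2[of "(c - u n) + (c - v n)"]
    unfolding real_norm_def abs_of_nonneg[OF zero_le_power2]
    by (simp add: power2_eq_square algebra_simps)
qed

lemma l2_dist_square:
  assumes "summable (\<lambda>n. (u n - v n)\<^sup>2)"
  shows "(l2_dist u v)\<^sup>2 = (\<Sum>n. (u n - v n)\<^sup>2)"
  unfolding l2_dist_def using suminf_nonneg[OF assms] by simp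

lemma l2_dist_triangle:
  assumes uv: "summable (\<lambda>n. (u n - v n)\<^sup>2)" and vw: "summable (\<lambda>n. (v n - w n)\<^sup>2)"
    and uw: "summable (\<lambda>n. (u n - w n)\<^sup>2)"
  shows "l2_dist u w \<le> l2_dist u v + l2_dist v w"
proof -
  have lim: "(\<lambda>N. L2_set (\<lambda>n. s n - t n) {..<N}) \<longlonglongrightarrow> l2_dist s t"
    if "summable (\<lambda>n. (s n - t n)\<^sup>2)" for s t :: "nat \<Rightarrow> real"
    unfolding L2_set_def l2_dist_def using that by (intro tendsto_real_sqrt summable_LIMSEQ)
  show ?thesis
  proof (rule LIMSEQ_le[OF lim[OF uw] tendsto_add[OF lim[OF uv] lim[OF vw]]], intro exI allI impI)
    show "L2_set (\<lambda>n. u n - w n) {..<N} \<le> L2_set (\<lambda>n. u n - v n) {..<N} + L2_set (\<lambda>n. v n - w n) {..<N}" for N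
      using L2_set_triangle_ineq[of "\<lambda>n. u n - v n" "\<lambda>n. v n - w n" "{..<N}"] by simp
  qed
qed

section \<open>Intrinsic pseudo metrics and vanishing energy\<close>

context weighted_graph
begin

lemma summable_b_bounded:
  assumes x: "x \<in> X" and g: "\<And>y. y \<in> X \<Longrightarrow> 0 \<le> g y \<and> g y \<le> B"
  shows "(\<lambda>y. b x y * g y) summable_on X"
proof (rule summable_on_comparison_test)
  show "(\<lambda>y. b x y * B) summable_on X"
    using b_summable[OF x] by (rule summable_on_cmult_left)
qed (use g b_nonneg[OF x] in \<open>auto intro: mult_left_mono\<close>)

lemma \<Gamma>_nonneg: "x \<in> X \<Longrightarrow> 0 \<le> \<Gamma> X b m f x"
  unfolding \<Gamma>_def using m_pos[of x] b_nonneg[of x]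
  by (intro mult_nonneg_nonneg infsum_nonneg) (auto simp: less_imp_le)

lemma graph_complete_of_intrinsic:
  assumes d: "pseudo_metric_on X d" and i: "intrinsic X b m d" and fb: "has_finite_balls X d"
  shows "graph_complete X b m"
proof (cases "X = {}")
  case True
  then show ?thesis
    unfolding graph_complete_def nondecreasing_Cc_to_one_def Cc_def
    by (intro exI[of _ "\<lambda>k x. undefined"]) (auto simp: uniform_limit_iff)
next
  case False
  then obtain a where a: "a \<in> X" by blast
  define \<eta> :: "nat \<Rightarrow> 'a \<Rightarrow> real" where "\<eta> k = (\<lambda>x\<in>X. max 0 (1 - d a x / real (Suc k)))" for k
  have d0: "0 \<le> d x y" if "x \<in> X" "y \<in> X" for x y
    using d that unfolding pseudo_metric_on_def by blast
  have lip: "\<bar>\<eta> k x - \<eta> k y\<bar> \<le> d x y / real (Suc k)" if xy: "x \<in> X" "y \<in> X" for k x y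
  proof -
    have "d a x \<le> d a y + d x y" "d a y \<le> d a x + d x y"
      using d a xy unfolding pseudo_metric_on_def by metis+
    then have "d a x / real (Suc k) \<le> d a y / real (Suc k) + d x y / real (Suc k)"
      "d a y / real (Suc k) \<le> d a x / real (Suc k) + d x y / real (Suc k)"
      by (auto simp: divide_simps)
    then show ?thesis using xy d0[OF xy] by (simp add: \<eta>_def del: of_nat_Suc)
  qed
  have Cc: "\<eta> k \<in> Cc X" for k
  proof -
    have "{x \<in> X. \<eta> k x \<noteq> 0} \<subseteq> {x \<in> X. d a x \<le> real (Suc k)}"
      by (auto simp: \<eta>_def max_def field_simps split: if_splits)
    moreover have "finite {x \<in> X. d a x \<le> real (Suc k)}"
      using fb a unfolding has_finite_balls_def by blast
    ultimately have "finite {x \<in> X. \<eta> k x \<noteq> 0}" by (rule finite_subset)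
    then show ?thesis unfolding Cc_def \<eta>_def by blast
  qed
  have inc: "incseq (\<lambda>k. \<eta> k x)" if x: "x \<in> X" for x
  proof (rule incseq_SucI)
    fix k
    have "d a x / real (Suc (Suc k)) \<le> d a x / real (Suc k)"
      using d0[OF a x] by (intro divide_left_mono) auto
    then show "\<eta> k x \<le> \<eta> (Suc k) x" using x by (simp add: \<eta>_def del: of_nat_Suc)
  qed
  have lim: "(\<lambda>k. \<eta> k x) \<longlonglongrightarrow> 1" if x: "x \<in> X" for x
  proof -
    have "(\<lambda>k. d a x * inverse (real (Suc k))) \<longlonglongrightarrow> d a x * 0"
      by (rule tendsto_mult[OF tendsto_const LIMSEQ_inverse_real_of_nat])
    then have "(\<lambda>k. max 0 (1 - d a x * inverse (real (Suc k)))) \<longlonglongrightarrow> max 0 (1 - d a x * 0)"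
      by (intro tendsto_max tendsto_diff tendsto_const)
    then show ?thesis using x by (simp add: \<eta>_def divide_inverse)
  qed
  have \<Gamma>le: "\<Gamma> X b m (\<eta> k) x \<le> (inverse (real (Suc k)))\<^sup>2" if x: "x \<in> X" for k x
  proof -
    let ?c = "(inverse (real (Suc k)))\<^sup>2"
    have s: "(\<lambda>y. b x y * (d x y)\<^sup>2) summable_on X"
      and le1: "(1 / m x) * (\<Sum>\<^sub>\<infinity>y\<in>X. b x y * (d x y)\<^sup>2) \<le> 1"
      using i x unfolding intrinsic_def by auto
    have "(\<Sum>\<^sub>\<infinity>y\<in>X. b x y * (norm (\<eta> k x - \<eta> k y))\<^sup>2) \<le> (\<Sum>\<^sub>\<infinity>y\<in>X. ?c * (b x y * (d x y)\<^sup>2))"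
    proof (rule infsum_mono)
      fix y assume y: "y \<in> X"
      have "(norm (\<eta> k x - \<eta> k y))\<^sup>2 \<le> (d x y / real (Suc k))\<^sup>2"
        using lip[OF x y] by (intro power_mono) auto
      then have "b x y * (norm (\<eta> k x - \<eta> k y))\<^sup>2 \<le> b x y * (d x y / real (Suc k))\<^sup>2"
        using b_nonneg[OF x y] by (rule mult_left_mono)
      also have "\<dots> = ?c * (b x y * (d x y)\<^sup>2)"
        by (simp add: divide_inverse power_mult_distrib del: of_nat_Suc)
      finally show "b x y * (norm (\<eta> k x - \<eta> k y))\<^sup>2 \<le> ?c * (b x y * (d x y)\<^sup>2)" .
    qed (use \<Gamma>_summable[OF Cc x] s in \<open>auto intro: summable_on_cmult_right\<close>)
    also have "\<dots> = ?c * (\<Sum>\<^sub>\<infinity>y\<in>X. b x y * (d x y)\<^sup>2)"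
      by (rule infsum_cmult_right')
    finally have "\<Gamma> X b m (\<eta> k) x \<le> (1 / m x) * (?c * (\<Sum>\<^sub>\<infinity>y\<in>X. b x y * (d x y)\<^sup>2))"
      unfolding \<Gamma>_def using m_pos[OF x] by (intro mult_left_mono) auto
    also have "\<dots> = ?c * ((1 / m x) * (\<Sum>\<^sub>\<infinity>y\<in>X. b x y * (d x y)\<^sup>2))" by simp
    also have "\<dots> \<le> ?c * 1" using le1 by (intro mult_left_mono) auto
    finally show ?thesis by simp
  qed
  have "uniform_limit X (\<lambda>k. \<Gamma> X b m (\<eta> k)) (\<lambda>_. 0) sequentially"
  proof (rule uniform_limitI)
    fix e :: real assume e: "e > 0"
    have "(\<lambda>k. (inverse (real (Suc k)))\<^sup>2) \<longlonglongrightarrow> 0\<^sup>2"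
      by (intro tendsto_power LIMSEQ_inverse_real_of_nat)
    then have "\<forall>\<^sub>F k in sequentially. (inverse (real (Suc k)))\<^sup>2 < e"
      using e by (intro order_tendstoD) auto
    then show "\<forall>\<^sub>F k in sequentially. \<forall>x\<in>X. dist (\<Gamma> X b m (\<eta> k) x) 0 < e"
    proof eventually_elim
      case (elim k)
      then show ?case
        using \<Gamma>le[of _ k] \<Gamma>_nonneg[of _ "\<eta> k"] by (force simp: dist_real_def)
    qed
  qed
  then show ?thesis
    unfolding graph_complete_def nondecreasing_Cc_to_one_def using Cc inc lim by blast
qed

lemma intrinsic_of_graph_complete:
  assumes "graph_complete X b m"
  obtains d where "pseudo_metric_on X d" "intrinsic X b m d" "has_finite_balls X d"
proof -
  obtain \<eta> :: "nat \<Rightarrow> 'a \<Rightarrow> real" where Cc: "\<And>k. \<eta> k \<in> Cc X" and lim: "\<And>x. x \<in> X \<Longrightarrow> (\<lambda>k. \<eta> k x) \<longlonglongrightarrow> 1"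
    and ul: "uniform_limit X (\<lambda>k. \<Gamma> X b m (\<eta> k)) (\<lambda>_. 0) sequentially"
    using assms unfolding graph_complete_def nondecreasing_Cc_to_one_def by blast
  \<comment> \<open>Closeness to \<open>1\<close> is demanded only at the vertices with index up to \<open>n\<close> in an enumeration;
    every fixed vertex is eventually among them. The membership premise covers the empty graph, where
    \<open>from_nat_into\<close> is arbitrary.\<close>
  have "\<exists>k. (\<forall>x\<in>X. \<Gamma> X b m (\<eta> k) x \<le> (1/2)^Suc n) \<and>
      (\<forall>i\<in>{..n}. from_nat_into X i \<in> X \<longrightarrow> \<bar>1 - \<eta> k (from_nat_into X i)\<bar> \<le> (1/2)^n)" for n :: nat
  proof -
    have "\<forall>\<^sub>F k in sequentially. \<forall>x\<in>X. dist (\<Gamma> X b m (\<eta> k) x) 0 < (1/2)^Suc n"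
      by (rule uniform_limitD[OF ul]) simp
    moreover have "\<forall>\<^sub>F k in sequentially. \<forall>i\<in>{..n}. from_nat_into X i \<in> X \<longrightarrow>
        dist (\<eta> k (from_nat_into X i)) 1 < (1/2)^n"
    proof (intro eventually_ball_finite ballI)
      fix i
      show "\<forall>\<^sub>F k in sequentially. from_nat_into X i \<in> X \<longrightarrow>
          dist (\<eta> k (from_nat_into X i)) 1 < (1/2)^n"
        using tendstoD[OF lim[of "from_nat_into X i"], of "(1/2)^n"]
        by (cases "from_nat_into X i \<in> X") auto
    qed simp
    ultimately have "\<forall>\<^sub>F k in sequentially. (\<forall>x\<in>X. \<Gamma> X b m (\<eta> k) x \<le> (1/2)^Suc n) \<and>
      (\<forall>i\<in>{..n}. from_nat_into X i \<in> X \<longrightarrow> \<bar>1 - \<eta> k (from_nat_into X i)\<bar> \<le> (1/2)^n)"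
    proof eventually_elim
      case (elim k)
      then show ?case by (force simp: dist_real_def abs_minus_commute)
    qed
    then show ?thesis by (rule eventually_happens'[OF sequentially_bot])
  qed
  then obtain k where k\<Gamma>: "\<And>n x. x \<in> X \<Longrightarrow> \<Gamma> X b m (\<eta> (k n)) x \<le> (1/2)^Suc n"
    and k1: "\<And>n i. i \<le> n \<Longrightarrow> from_nat_into X i \<in> X \<Longrightarrow>
        \<bar>1 - \<eta> (k n) (from_nat_into X i)\<bar> \<le> (1/2)^n"
    by (metis atMost_iff)
  define \<phi> where "\<phi> x n = \<eta> (k n) x" for x n
  have near1: "\<exists>N. \<forall>n\<ge>N. \<bar>1 - \<phi> x n\<bar> \<le> (1/2)^n" if "x \<in> X" for x
    using k1 from_nat_into_surj[OF countable_vertices that] that unfolding \<phi>_def by metis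
  have sum1: "summable (\<lambda>n. (1 - \<phi> x n)\<^sup>2)" if x: "x \<in> X" for x
  proof -
    obtain N where N: "\<And>n. n \<ge> N \<Longrightarrow> \<bar>1 - \<phi> x n\<bar> \<le> (1/2)^n"
      using near1[OF x] by blast
    show ?thesis
    proof (rule summable_comparison_test')
      show "summable (\<lambda>n. (1/4::real)^n)" by (simp add: summable_geometric)
      fix n assume "n \<ge> N"
      then have "\<bar>1 - \<phi> x n\<bar>\<^sup>2 \<le> ((1/2)^n)\<^sup>2"
        using N by (intro power_mono) auto
      also have "\<dots> = (1/4)^n"
        by (simp add: power2_eq_square power_mult_distrib[symmetric])
      finally show "norm ((1 - \<phi> x n)\<^sup>2) \<le> (1/4)^n" by simp
    qed
  qed
  have sum\<phi>: "summable (\<lambda>n. (\<phi> x n - \<phi> y n)\<^sup>2)" if "x \<in> X" "y \<in> X" for x y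
    by (rule summable_square_diff[OF sum1[OF that(1)] sum1[OF that(2)]])
  define d where "d x y = l2_dist (\<phi> x) (\<phi> y)" for x y
  have d2: "(d x y)\<^sup>2 = (\<Sum>n. (\<phi> x n - \<phi> y n)\<^sup>2)" if "x \<in> X" "y \<in> X" for x y
    unfolding d_def using sum\<phi>[OF that] by (rule l2_dist_square)
  show thesis
  proof (rule that[of d])
    show "pseudo_metric_on X d"
      unfolding pseudo_metric_on_def
    proof (intro conjI ballI)
      show "d x z \<le> d x y + d y z" if "x \<in> X" "y \<in> X" "z \<in> X" for x y z
        unfolding d_def using that by (intro l2_dist_triangle sum\<phi>)
      show "0 \<le> d x y" if "x \<in> X" "y \<in> X" for x y
        unfolding d_def l2_dist_def using suminf_nonneg[OF sum\<phi>[OF that]] by simp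
    qed (simp_all add: d_def l2_dist_def power2_commute)
    show "intrinsic X b m d"
      unfolding intrinsic_def
    proof (intro ballI)
      fix x assume x: "x \<in> X"
      have fin: "(\<Sum>y\<in>F. b x y * (d x y)\<^sup>2) \<le> m x" if F: "finite F" "F \<subseteq> X" for F
      proof -
        have "(\<Sum>y\<in>F. b x y * (d x y)\<^sup>2) = (\<Sum>y\<in>F. \<Sum>n. b x y * (\<phi> x n - \<phi> y n)\<^sup>2)"
          using F x by (intro sum.cong refl) (auto simp: d2 suminf_mult sum\<phi> subset_iff)
        also have "\<dots> = (\<Sum>n. \<Sum>y\<in>F. b x y * (\<phi> x n - \<phi> y n)\<^sup>2)"
          using F x by (intro suminf_sum[symmetric] summable_mult sum\<phi>) auto
        also have "\<dots> \<le> (\<Sum>n. m x * (1/2)^Suc n)"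
        proof (rule suminf_le)
          fix n
          have "(\<Sum>y\<in>F. b x y * (\<phi> x n - \<phi> y n)\<^sup>2)
              \<le> (\<Sum>\<^sub>\<infinity>y\<in>X. b x y * (norm (\<eta> (k n) x - \<eta> (k n) y))\<^sup>2)"
            using finite_sum_le_infsum[OF \<Gamma>_summable[OF Cc x] F] b_nonneg[OF x]
            by (simp add: \<phi>_def)
          also have "\<dots> = m x * \<Gamma> X b m (\<eta> (k n)) x"
            using m_pos[OF x] by (simp add: \<Gamma>_def)
          also have "\<dots> \<le> m x * (1/2)^Suc n"
            using k\<Gamma>[OF x] m_pos[OF x] by (intro mult_left_mono) auto
          finally show "(\<Sum>y\<in>F. b x y * (\<phi> x n - \<phi> y n)\<^sup>2) \<le> m x * (1/2)^Suc n" .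
        next
          show "summable (\<lambda>n. \<Sum>y\<in>F. b x y * (\<phi> x n - \<phi> y n)\<^sup>2)"
            using F x by (intro summable_sum summable_mult sum\<phi>) auto
          show "summable (\<lambda>n. m x * (1/2)^Suc n)"
            by (intro summable_mult sums_summable[OF power_half_series])
        qed
        also have "\<dots> = m x"
          using sums_mult[OF power_half_series, of "m x"] by (simp add: sums_iff)
        finally show ?thesis .
      qed
      have s: "(\<lambda>y. b x y * (d x y)\<^sup>2) summable_on X"
        using fin b_nonneg[OF x]
        by (intro nonneg_bdd_above_summable_on bdd_aboveI[of _ "m x"]) auto
      moreover have "(\<Sum>\<^sub>\<infinity>y\<in>X. b x y * (d x y)\<^sup>2) \<le> m x"
        by (rule infsum_le_finite_sums[OF s fin])
      ultimately show "(\<lambda>y. b x y * (d x y)\<^sup>2) summable_on X \<and>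
          (1 / m x) * (\<Sum>\<^sub>\<infinity>y\<in>X. b x y * (d x y)\<^sup>2) \<le> 1"
        using m_pos[OF x] by (simp add: field_simps)
    qed
    show "has_finite_balls X d"
      unfolding has_finite_balls_def
    proof (intro ballI allI)
      fix x r assume x: "x \<in> X"
      obtain N0 where N0: "\<And>n. n \<ge> N0 \<Longrightarrow> \<bar>1 - \<phi> x n\<bar> \<le> (1/2)^n"
        using near1[OF x] by blast
      \<comment> \<open>The successor ensures \<open>(1/2)^n \<le> 1/2\<close> from \<open>J\<close> on.\<close>
      define J where "J = Suc N0"
      have half: "\<phi> x n \<ge> 1/2" if "n \<ge> J" for n
      proof -
        have "(1/2::real)^n \<le> (1/2)^1" using that by (intro power_decreasing) (auto simp: J_def)
        then show ?thesis using N0[of n] that unfolding J_def by simp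
      qed
      \<comment> \<open>A vertex missed by the \<open>N\<close> cutoffs starting at \<open>J\<close> has squared distance at least
        \<open>N / 4 > r\<^sup>2\<close> from \<open>x\<close>.\<close>
      obtain N where N: "4 * r\<^sup>2 < real N" using reals_Archimedean2 by blast
      have "{y \<in> X. d x y \<le> r} \<subseteq> (\<Union>n\<in>{J..<J + N}. {y \<in> X. \<eta> (k n) y \<noteq> 0})"
      proof
        fix y assume "y \<in> {y \<in> X. d x y \<le> r}"
        then have y: "y \<in> X" and yr: "d x y \<le> r" by auto
        show "y \<in> (\<Union>n\<in>{J..<J + N}. {y \<in> X. \<eta> (k n) y \<noteq> 0})"
        proof (rule ccontr)
          assume "\<not> ?thesis"
          then have z: "\<phi> y n = 0" if "n \<in> {J..<J + N}" for n
            using that y unfolding \<phi>_def by blast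
          have "real N / 4 = (\<Sum>n\<in>{J..<J + N}. (1/2)\<^sup>2)" by (simp add: power2_eq_square)
          also have "\<dots> \<le> (\<Sum>n\<in>{J..<J + N}. (\<phi> x n - \<phi> y n)\<^sup>2)"
            using half z by (intro sum_mono power_mono) auto
          also have "\<dots> \<le> (d x y)\<^sup>2"
            unfolding d2[OF x y] by (intro sum_le_suminf sum\<phi> x y) auto
          also have "\<dots> \<le> r\<^sup>2"
            using yr suminf_nonneg[OF sum\<phi>[OF x y]] by (intro power_mono) (auto simp: d_def l2_dist_def)
          finally show False using N by simp
        qed
      qed
      moreover have "finite (\<Union>n\<in>{J..<J + N}. {y \<in> X. \<eta> (k n) y \<noteq> 0})"
        using Cc unfolding Cc_def by auto
      ultimately show "finite {y \<in> X. d x y \<le> r}" by (rule finite_subset)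
    qed
  qed
qed

section \<open>Bounded energy\<close>

lemma chi_complete_of_graph_complete:
  assumes "graph_complete X b m"
  shows "chi_complete X b m"
proof -
  obtain \<eta> where \<eta>: "nondecreasing_Cc_to_one X \<eta>"
    and ul: "uniform_limit X (\<lambda>k. \<Gamma> X b m (\<eta> k)) (\<lambda>_. 0) sequentially"
    using assms unfolding graph_complete_def by blast
  obtain K where K: "\<And>k x. k \<ge> K \<Longrightarrow> x \<in> X \<Longrightarrow> dist (\<Gamma> X b m (\<eta> k) x) 0 < 1"
    using uniform_limitD[OF ul, of 1] unfolding eventually_sequentially by auto
  have "nondecreasing_Cc_to_one X (\<lambda>k. \<eta> (k + K))"
    using \<eta> unfolding nondecreasing_Cc_to_one_def
    by (auto simp: incseq_def intro: LIMSEQ_ignore_initial_segment)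
  moreover have "\<forall>k. \<forall>x\<in>X. \<Gamma> X b m (\<eta> (k + K)) x \<le> 1"
  proof (intro allI ballI)
    show "\<Gamma> X b m (\<eta> (k + K)) x \<le> 1" if "x \<in> X" for k x
      using K[of "k + K" x] that by (simp add: dist_real_def)
  qed
  ultimately show ?thesis unfolding chi_complete_def by blast
qed

text \<open>
  The absolute values make this an upper bound for the polarization of \<open>\<Gamma>\<close>; an upper bound is all
  that the energy of a sum requires, and nonnegative terms keep the estimates below termwise.
\<close>

definition cross_energy :: "('a \<Rightarrow> real) \<Rightarrow> ('a \<Rightarrow> real) \<Rightarrow> 'a \<Rightarrow> real" where
  "cross_energy f g x = (1 / m x) * (\<Sum>\<^sub>\<infinity>y\<in>X. b x y * (\<bar>f x - f y\<bar> * \<bar>g x - g y\<bar>))"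

lemma abs_diff_le_twice_bound:
  fixes f :: "'a \<Rightarrow> real"
  assumes "\<And>z. z \<in> X \<Longrightarrow> \<bar>f z\<bar> \<le> B" "x \<in> X" "y \<in> X"
  shows "\<bar>f x - f y\<bar> \<le> 2 * B"
  using assms(1)[OF assms(2)] assms(1)[OF assms(3)] by linarith

lemma \<Gamma>_add_le:
  fixes f g :: "'a \<Rightarrow> real"
  assumes f: "f \<in> Cc X" and g: "g \<in> Cc X" and x: "x \<in> X"
  shows "\<Gamma> X b m (\<lambda>x\<in>X. f x + g x) x \<le> \<Gamma> X b m f x + \<Gamma> X b m g x + 2 * cross_energy f g x"
proof -
  obtain B where B: "0 \<le> B" "\<And>z. z \<in> X \<Longrightarrow> \<bar>f z\<bar> \<le> B" using Cc_bounded[OF f] by metis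
  obtain D where D: "0 \<le> D" "\<And>z. z \<in> X \<Longrightarrow> \<bar>g z\<bar> \<le> D" using Cc_bounded[OF g] by metis
  note sf = \<Gamma>_summable[OF f x] and sg = \<Gamma>_summable[OF g x]
  have sc: "(\<lambda>y. b x y * (\<bar>f x - f y\<bar> * \<bar>g x - g y\<bar>)) summable_on X"
  proof (rule summable_b_bounded[OF x])
    show "0 \<le> \<bar>f x - f y\<bar> * \<bar>g x - g y\<bar> \<and> \<bar>f x - f y\<bar> * \<bar>g x - g y\<bar> \<le> (2 * B) * (2 * D)"
      if y: "y \<in> X" for y
      using abs_diff_le_twice_bound[OF B(2) x y] abs_diff_le_twice_bound[OF D(2) x y] B(1)
      by (intro conjI mult_mono) auto
  qed
  have "(\<Sum>\<^sub>\<infinity>y\<in>X. b x y * (norm ((\<lambda>x\<in>X. f x + g x) x - (\<lambda>x\<in>X. f x + g x) y))\<^sup>2)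
     \<le> (\<Sum>\<^sub>\<infinity>y\<in>X. (b x y * (norm (f x - f y))\<^sup>2 + b x y * (norm (g x - g y))\<^sup>2)
          + 2 * (b x y * (\<bar>f x - f y\<bar> * \<bar>g x - g y\<bar>)))"
  proof (rule infsum_mono)
    show "(\<lambda>y. b x y * (norm ((\<lambda>x\<in>X. f x + g x) x - (\<lambda>x\<in>X. f x + g x) y))\<^sup>2) summable_on X"
      by (rule \<Gamma>_summable[OF Cc_add[OF f g] x])
    show "(\<lambda>y. (b x y * (norm (f x - f y))\<^sup>2 + b x y * (norm (g x - g y))\<^sup>2)
          + 2 * (b x y * (\<bar>f x - f y\<bar> * \<bar>g x - g y\<bar>))) summable_on X"
      by (intro summable_on_add sf sg summable_on_cmult_right sc)
    fix y assume y: "y \<in> X"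
    have "((f x - f y) + (g x - g y))\<^sup>2 \<le> (f x - f y)\<^sup>2 + (g x - g y)\<^sup>2 + 2 * (\<bar>f x - f y\<bar> * \<bar>g x - g y\<bar>)"
      unfolding power2_sum abs_mult[symmetric]
      using abs_ge_self[of "(f x - f y) * (g x - g y)"] by linarith
    from mult_left_mono[OF this b_nonneg[OF x y]]
    show "b x y * (norm ((\<lambda>x\<in>X. f x + g x) x - (\<lambda>x\<in>X. f x + g x) y))\<^sup>2
      \<le> (b x y * (norm (f x - f y))\<^sup>2 + b x y * (norm (g x - g y))\<^sup>2)
          + 2 * (b x y * (\<bar>f x - f y\<bar> * \<bar>g x - g y\<bar>))"
      using x y by (simp add: algebra_simps)
  qed
  also have "\<dots> = ((\<Sum>\<^sub>\<infinity>y\<in>X. b x y * (norm (f x - f y))\<^sup>2) + (\<Sum>\<^sub>\<infinity>y\<in>X. b x y * (norm (g x - g y))\<^sup>2))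
      + 2 * (\<Sum>\<^sub>\<infinity>y\<in>X. b x y * (\<bar>f x - f y\<bar> * \<bar>g x - g y\<bar>))"
    by (simp only: infsum_add summable_on_add sf sg summable_on_cmult_right sc infsum_cmult_right')
  finally have "\<Gamma> X b m (\<lambda>x\<in>X. f x + g x) x \<le> (1 / m x) *
      (((\<Sum>\<^sub>\<infinity>y\<in>X. b x y * (norm (f x - f y))\<^sup>2) + (\<Sum>\<^sub>\<infinity>y\<in>X. b x y * (norm (g x - g y))\<^sup>2))
      + 2 * (\<Sum>\<^sub>\<infinity>y\<in>X. b x y * (\<bar>f x - f y\<bar> * \<bar>g x - g y\<bar>)))"
    unfolding \<Gamma>_def using m_pos[OF x] by (intro mult_left_mono) auto
  then show ?thesis unfolding \<Gamma>_def cross_energy_def by (simp add: algebra_simps)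
qed

lemma \<Gamma>_cmult:
  fixes f :: "'a \<Rightarrow> real"
  assumes x: "x \<in> X"
  shows "\<Gamma> X b m (\<lambda>x\<in>X. c * f x) x = c\<^sup>2 * \<Gamma> X b m f x"
proof -
  have "(\<Sum>\<^sub>\<infinity>y\<in>X. b x y * (norm ((\<lambda>x\<in>X. c * f x) x - (\<lambda>x\<in>X. c * f x) y))\<^sup>2)
      = (\<Sum>\<^sub>\<infinity>y\<in>X. c\<^sup>2 * (b x y * (norm (f x - f y))\<^sup>2))"
    using x by (intro infsum_cong)
      (auto simp: power_mult_distrib right_diff_distrib[symmetric])
  then show ?thesis unfolding \<Gamma>_def by (simp add: infsum_cmult_right')
qed

text \<open>Monotonicity traps every \<open>\<eta> k\<close> between the bounded function \<open>\<eta> 0\<close> and the limit \<open>1\<close>.\<close>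

lemma nondecreasing_Cc_to_one_bounded:
  assumes "nondecreasing_Cc_to_one X \<eta>"
  obtains M where "0 \<le> M" "\<And>k x. x \<in> X \<Longrightarrow> \<bar>\<eta> k x\<bar> \<le> M"
proof -
  have "\<eta> 0 \<in> Cc X" using assms unfolding nondecreasing_Cc_to_one_def by blast
  then obtain B where B: "0 \<le> B" "\<And>x. x \<in> X \<Longrightarrow> \<bar>\<eta> 0 x\<bar> \<le> B"
    using Cc_bounded by metis
  show thesis
  proof (rule that[of "max 1 B"])
    fix k x assume x: "x \<in> X"
    have inc: "incseq (\<lambda>k. \<eta> k x)" and lim: "(\<lambda>k. \<eta> k x) \<longlonglongrightarrow> 1"
      using assms x unfolding nondecreasing_Cc_to_one_def by auto
    show "\<bar>\<eta> k x\<bar> \<le> max 1 B"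
      using incseq_le[OF inc lim, of k] incseqD[OF inc, of 0 k] B(2)[OF x] by auto
  qed auto
qed

lemma cross_energy_tendsto_0:
  assumes f: "f \<in> Cc X" and \<eta>: "nondecreasing_Cc_to_one X \<eta>" and x: "x \<in> X"
  shows "(\<lambda>k. cross_energy f (\<eta> k) x) \<longlonglongrightarrow> 0"
proof -
  obtain B where B: "0 \<le> B" "\<And>z. z \<in> X \<Longrightarrow> \<bar>f z\<bar> \<le> B" using Cc_bounded[OF f] by metis
  obtain M where M: "0 \<le> M" "\<And>k z. z \<in> X \<Longrightarrow> \<bar>\<eta> k z\<bar> \<le> M"
    using nondecreasing_Cc_to_one_bounded[OF \<eta>] by metis
  have "(\<lambda>k. \<Sum>\<^sub>\<infinity>y\<in>X. b x y * (\<bar>f x - f y\<bar> * \<bar>\<eta> k x - \<eta> k y\<bar>)) \<longlonglongrightarrow> 0"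
  proof (rule infsum_dominated_tendsto_0)
    show "(\<lambda>y. b x y * ((2 * B) * (2 * M))) summable_on X"
      using b_summable[OF x] by (rule summable_on_cmult_left)
    fix y assume y: "y \<in> X"
    show "\<bar>b x y * (\<bar>f x - f y\<bar> * \<bar>\<eta> k x - \<eta> k y\<bar>)\<bar> \<le> b x y * ((2 * B) * (2 * M))" for k
      unfolding abs_mult abs_abs abs_of_nonneg[OF b_nonneg[OF x y]]
      by (intro mult_mono order_refl abs_diff_le_twice_bound B M x y)
        (use B(1) M(1) b_nonneg[OF x y] in auto)
    have "(\<lambda>k. b x y * (\<bar>f x - f y\<bar> * \<bar>\<eta> k x - \<eta> k y\<bar>)) \<longlonglongrightarrow> b x y * (\<bar>f x - f y\<bar> * \<bar>1 - 1\<bar>)"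
      using \<eta> x y unfolding nondecreasing_Cc_to_one_def by (intro tendsto_intros) auto
    then show "(\<lambda>k. b x y * (\<bar>f x - f y\<bar> * \<bar>\<eta> k x - \<eta> k y\<bar>)) \<longlonglongrightarrow> 0" by simp
  qed
  from tendsto_mult_left[OF this, of "1 / m x"] show ?thesis
    unfolding cross_energy_def by simp
qed

text \<open>
  At a vertex \<open>x\<close> off the support \<open>S\<close> of \<open>f\<close> only neighbours in \<open>S\<close> contribute, so the cross energy
  is at most a constant times \<open>\<Sum>y\<in>S. b x y / m x\<close>, uniformly in \<open>k\<close>. As a finite sum of functions
  vanishing at infinity this is small outside a finite set, and on finitely many vertices
  pointwise convergence is uniform.
\<close>

lemma eventually_cross_energy_le:
  assumes C0: "\<And>y. y \<in> X \<Longrightarrow> (\<lambda>x\<in>X. b x y / m x) \<in> C0 X"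
    and f: "f \<in> Cc X" and \<eta>: "nondecreasing_Cc_to_one X \<eta>" and e: "e > 0"
  shows "\<forall>\<^sub>F k in sequentially. \<forall>x\<in>X. cross_energy f (\<eta> k) x \<le> e"
proof -
  obtain B where B: "0 \<le> B" "\<And>z. z \<in> X \<Longrightarrow> \<bar>f z\<bar> \<le> B" using Cc_bounded[OF f] by metis
  obtain M where M: "0 \<le> M" "\<And>k z. z \<in> X \<Longrightarrow> \<bar>\<eta> k z\<bar> \<le> M"
    using nondecreasing_Cc_to_one_bounded[OF \<eta>] by metis
  define S where "S = {x \<in> X. f x \<noteq> 0}"
  have S: "finite S" "S \<subseteq> X" using f unfolding S_def Cc_def by auto
  \<comment> \<open>A neighbour \<open>y \<in> S\<close> contributes at most \<open>B * (2 * M)\<close> times \<open>b x y / m x\<close>; the threshold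
    \<open>e / (D + 1)\<close> below avoids dividing by \<open>D = 0\<close>.\<close>
  define D where "D = real (card S) * (B * (2 * M))"
  have D: "0 \<le> D" unfolding D_def using B(1) M(1) by simp
  define K where "K = S \<union> (\<Union>y\<in>S. {x \<in> X. e / (D + 1) \<le> \<bar>(\<lambda>x\<in>X. b x y / m x) x\<bar>})"
  have K: "finite K" "K \<subseteq> X"
  proof -
    have "finite {x \<in> X. e / (D + 1) \<le> \<bar>(\<lambda>x\<in>X. b x y / m x) x\<bar>}" if "y \<in> S" for y
      using that S e D by (intro C0_finite_superlevel C0) auto
    then show "finite K" unfolding K_def using S(1) by simp
    show "K \<subseteq> X" unfolding K_def using S by blast
  qed
  have inside: "\<forall>\<^sub>F k in sequentially. \<forall>x\<in>K. cross_energy f (\<eta> k) x < e"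
  proof (rule eventually_ball_finite[OF K(1)], rule ballI)
    fix x assume "x \<in> K"
    then have "x \<in> X" using K(2) by blast
    from order_tendstoD(2)[OF cross_energy_tendsto_0[OF f \<eta> this] e]
    show "\<forall>\<^sub>F k in sequentially. cross_energy f (\<eta> k) x < e" .
  qed
  have outside: "cross_energy f (\<eta> k) x \<le> e" if x: "x \<in> X" "x \<notin> K" for k x
  proof -
    have fx: "f x = 0" using x unfolding K_def S_def by auto
    have "(\<Sum>\<^sub>\<infinity>y\<in>X. b x y * (\<bar>f x - f y\<bar> * \<bar>\<eta> k x - \<eta> k y\<bar>))
        = (\<Sum>\<^sub>\<infinity>y\<in>S. b x y * (\<bar>f x - f y\<bar> * \<bar>\<eta> k x - \<eta> k y\<bar>))"
      by (rule infsum_cong_neutral) (use fx in \<open>auto simp: S_def\<close>)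
    also have "\<dots> = (\<Sum>y\<in>S. b x y * (\<bar>f x - f y\<bar> * \<bar>\<eta> k x - \<eta> k y\<bar>))"
      using S by simp
    finally have "cross_energy f (\<eta> k) x
        = (\<Sum>y\<in>S. (b x y / m x) * (\<bar>f x - f y\<bar> * \<bar>\<eta> k x - \<eta> k y\<bar>))"
      unfolding cross_energy_def by (simp add: sum_distrib_left)
    also have "\<dots> \<le> (\<Sum>y\<in>S. (e / (D + 1)) * (B * (2 * M)))"
    proof (intro sum_mono mult_mono)
      fix y assume y: "y \<in> S"
      then have yX: "y \<in> X" using S by auto
      have "b x y / m x \<ge> 0" using b_nonneg[OF x(1) yX] m_pos[OF x(1)] by simp
      moreover have "\<not> e / (D + 1) \<le> \<bar>(\<lambda>x\<in>X. b x y / m x) x\<bar>"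
        using x y unfolding K_def by blast
      ultimately show "b x y / m x \<le> e / (D + 1)"
        using x(1) by (simp del: abs_divide)
      show "\<bar>f x - f y\<bar> \<le> B" using B(2)[OF yX] fx by simp
      show "\<bar>\<eta> k x - \<eta> k y\<bar> \<le> 2 * M" by (rule abs_diff_le_twice_bound[OF M(2) x(1) yX])
    qed (use e D B(1) M(1) in auto)
    also have "\<dots> = real (card S) * ((e / (D + 1)) * (B * (2 * M)))" by (rule sum_constant)
    also have "\<dots> = (e / (D + 1)) * D" by (simp only: D_def mult.left_commute)
    also have "\<dots> \<le> e" using e D by (simp add: divide_simps)
    finally show ?thesis .
  qed
  show ?thesis
    using inside
  proof eventually_elim
    case (elim k)
    show ?case
    proof
      fix x assume x: "x \<in> X"
      show "cross_energy f (\<eta> k) x \<le> e"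
      proof (cases "x \<in> K")
        case True
        then show ?thesis using elim by (simp add: less_imp_le)
      next
        case False
        then show ?thesis using x outside by simp
      qed
    qed
  qed
qed

text \<open>
  The indices are chosen one at a time: the partial sum of the cutoffs selected so far is again
  finitely supported, so a later cutoff has cross energy at most \<open>1\<close> with it at every vertex.
  Hence each step adds at most \<open>C + 2\<close> to the energy of the partial sum, and dividing \<open>n + 1\<close>
  summands by \<open>n + 1\<close> divides the energy by \<open>(n + 1)\<^sup>2\<close>.
\<close>

lemma graph_complete_of_chi_complete:
  assumes C0: "\<And>y. y \<in> X \<Longrightarrow> (\<lambda>x\<in>X. b x y / m x) \<in> C0 X"
    and chi: "chi_complete X b m"
  shows "graph_complete X b m"
proof -
  obtain \<eta> C where \<eta>: "nondecreasing_Cc_to_one X \<eta>"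
    and C: "\<And>k x. x \<in> X \<Longrightarrow> \<Gamma> X b m (\<eta> k) x \<le> C"
    using chi unfolding chi_complete_def by blast
  have Cc: "\<eta> k \<in> Cc X" for k using \<eta> unfolding nondecreasing_Cc_to_one_def by blast
  \<comment> \<open>A state consists of the last selected index and the sum of the cutoffs selected so far.\<close>
  define P :: "nat \<Rightarrow> nat \<times> ('a \<Rightarrow> real) \<Rightarrow> bool" where
    "P n s \<longleftrightarrow> snd s \<in> Cc X \<and> (\<forall>x\<in>X. \<Gamma> X b m (snd s) x \<le> real (Suc n) * (C + 2)) \<and>
       (n = 0 \<longrightarrow> snd s = \<eta> (fst s))" for n s
  define Q :: "nat \<Rightarrow> nat \<times> ('a \<Rightarrow> real) \<Rightarrow> nat \<times> ('a \<Rightarrow> real) \<Rightarrow> bool" where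
    "Q n s t \<longleftrightarrow> fst s < fst t \<and> snd t = (\<lambda>x\<in>X. snd s x + \<eta> (fst t) x)" for n s t
  have "\<exists>s. \<forall>n. P n (s n) \<and> Q n (s n) (s (Suc n))"
  proof (rule dependent_nat_choice)
    have "P 0 (0, \<eta> 0)" unfolding P_def using Cc C by (force intro: order_trans)
    then show "\<exists>s. P 0 s" by blast
  next
    fix s n assume s: "P n s"
    then have f: "snd s \<in> Cc X" and \<Gamma>f: "\<And>x. x \<in> X \<Longrightarrow> \<Gamma> X b m (snd s) x \<le> real (Suc n) * (C + 2)"
      unfolding P_def by auto
    have "\<forall>\<^sub>F k in sequentially. fst s < k \<and> (\<forall>x\<in>X. cross_energy (snd s) (\<eta> k) x \<le> 1)"
      using eventually_cross_energy_le[OF C0 f \<eta>, of 1] eventually_gt_at_top[of "fst s"]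
      by (auto intro: eventually_conj)
    from eventually_happens'[OF sequentially_bot this]
    obtain k where k: "fst s < k" "\<And>x. x \<in> X \<Longrightarrow> cross_energy (snd s) (\<eta> k) x \<le> 1"
      by blast
    let ?t = "(k, \<lambda>x\<in>X. snd s x + \<eta> k x)"
    have "\<Gamma> X b m (\<lambda>x\<in>X. snd s x + \<eta> k x) x \<le> real (Suc (Suc n)) * (C + 2)" if x: "x \<in> X" for x
      using \<Gamma>_add_le[OF f Cc x, of k] \<Gamma>f[OF x] C[OF x, of k] k(2)[OF x] by (simp add: algebra_simps)
    then have "P (Suc n) ?t" unfolding P_def using Cc_add[OF f Cc] by auto
    moreover have "Q n s ?t" unfolding Q_def using k by simp
    ultimately show "\<exists>t. P (Suc n) t \<and> Q n s t" by blast
  qed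
  then obtain s where P: "\<And>n. P n (s n)" and Q: "\<And>n. Q n (s n) (s (Suc n))" by blast
  define \<kappa> where "\<kappa> n = fst (s n)" for n
  have \<kappa>: "strict_mono \<kappa>" unfolding strict_mono_Suc_iff \<kappa>_def using Q by (auto simp: Q_def)
  have S: "snd (s n) x = (\<Sum>j\<le>n. \<eta> (\<kappa> j) x)" if x: "x \<in> X" for n x
  proof (induction n)
    case 0
    show ?case using P[of 0] by (simp add: P_def \<kappa>_def)
  next
    case (Suc n)
    have "snd (s (Suc n)) x = snd (s n) x + \<eta> (\<kappa> (Suc n)) x"
      using Q[of n] x by (simp add: Q_def \<kappa>_def)
    with Suc show ?case by simp
  qed
  define \<psi> where "\<psi> n = (\<lambda>x\<in>X. inverse (real (Suc n)) * snd (s n) x)" for n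
  have \<psi>: "\<psi> n x = (\<Sum>j\<le>n. \<eta> (\<kappa> j) x) / real (Suc n)" if "x \<in> X" for n x
    using that by (simp add: \<psi>_def S divide_inverse)
  have \<eta>\<kappa>: "incseq (\<lambda>j. \<eta> (\<kappa> j) x)" "(\<lambda>j. \<eta> (\<kappa> j) x) \<longlonglongrightarrow> 1" if x: "x \<in> X" for x
  proof -
    have inc: "incseq (\<lambda>k. \<eta> k x)" and lim: "(\<lambda>k. \<eta> k x) \<longlonglongrightarrow> 1"
      using \<eta> x unfolding nondecreasing_Cc_to_one_def by auto
    show "incseq (\<lambda>j. \<eta> (\<kappa> j) x)"
      using inc strict_mono_mono[OF \<kappa>] unfolding incseq_def mono_def by blast
    show "(\<lambda>j. \<eta> (\<kappa> j) x) \<longlonglongrightarrow> 1"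
      using LIMSEQ_subseq_LIMSEQ[OF lim \<kappa>] by (simp add: o_def)
  qed
  have "nondecreasing_Cc_to_one X \<psi>"
    unfolding nondecreasing_Cc_to_one_def
  proof (intro conjI allI ballI)
    show "\<psi> n \<in> Cc X" for n
      unfolding \<psi>_def using P[of n] by (intro Cc_cmult) (simp add: P_def)
    show "incseq (\<lambda>n. \<psi> n x)" "(\<lambda>n. \<psi> n x) \<longlonglongrightarrow> 1" if x: "x \<in> X" for x
      using incseq_cesaro_mean[OF \<eta>\<kappa>(1)[OF x]] tendsto_cesaro_mean_incseq[OF \<eta>\<kappa>[OF x]] x
      by (simp_all add: \<psi>)
  qed
  moreover have "uniform_limit X (\<lambda>n. \<Gamma> X b m (\<psi> n)) (\<lambda>_. 0) sequentially"
  proof (rule uniform_limitI)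
    fix e :: real assume e: "e > 0"
    have \<Gamma>le: "\<Gamma> X b m (\<psi> n) x \<le> (C + 2) * inverse (real (Suc n))" if x: "x \<in> X" for n x
    proof -
      have "\<Gamma> X b m (\<psi> n) x = (inverse (real (Suc n)))\<^sup>2 * \<Gamma> X b m (snd (s n)) x"
        unfolding \<psi>_def by (rule \<Gamma>_cmult[OF x])
      also have "\<dots> \<le> (inverse (real (Suc n)))\<^sup>2 * (real (Suc n) * (C + 2))"
        using P[of n] x by (intro mult_left_mono) (auto simp: P_def)
      also have "\<dots> = (C + 2) * inverse (real (Suc n))"
        by (simp add: power2_eq_square del: of_nat_Suc)
      finally show ?thesis .
    qed
    have "(\<lambda>n. (C + 2) * inverse (real (Suc n))) \<longlonglongrightarrow> (C + 2) * 0"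
      by (intro tendsto_intros LIMSEQ_inverse_real_of_nat)
    then have "\<forall>\<^sub>F n in sequentially. (C + 2) * inverse (real (Suc n)) < e"
      using e by (intro order_tendstoD) auto
    then show "\<forall>\<^sub>F n in sequentially. \<forall>x\<in>X. dist (\<Gamma> X b m (\<psi> n) x) 0 < e"
    proof eventually_elim
      case (elim n)
      then show ?case
        using \<Gamma>le[of _ n] \<Gamma>_nonneg[of _ "\<psi> n"] by (force simp: dist_real_def)
    qed
  qed
  ultimately show ?thesis unfolding graph_complete_def by blast
qed

end

theorem theoremA1:
  fixes X :: "'a set" and b :: "'a \<Rightarrow> 'a \<Rightarrow> real" and m :: "'a \<Rightarrow> real"
  assumes "weighted_graph X b m"
  shows "((\<exists>d. pseudo_metric_on X d \<and> intrinsic X b m d \<and> has_finite_balls X d)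
            \<longleftrightarrow> graph_complete X b m) \<and>
         ((\<forall>y\<in>X. (\<lambda>x\<in>X. b x y / m x) \<in> C0 X) \<longrightarrow>
            (graph_complete X b m \<longleftrightarrow> chi_complete X b m))"
proof -
  interpret weighted_graph X b m by fact
  have "(\<exists>d. pseudo_metric_on X d \<and> intrinsic X b m d \<and> has_finite_balls X d) \<longleftrightarrow> graph_complete X b m"
  proof
    assume "graph_complete X b m"
    then show "\<exists>d. pseudo_metric_on X d \<and> intrinsic X b m d \<and> has_finite_balls X d"
      by (rule intrinsic_of_graph_complete) blast
  qed (blast intro: graph_complete_of_intrinsic)
  moreover have "graph_complete X b m \<longleftrightarrow> chi_complete X b m"
    if "\<forall>y\<in>X. (\<lambda>x\<in>X. b x y / m x) \<in> C0 X"
    using graph_complete_of_chi_complete[OF bspec[OF that]] chi_complete_of_graph_complete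
    by (rule iffI[rotated])
  ultimately show ?thesis by blast
qed

end
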